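(* For every prime $p\geq 7$, $$\sum_{k=0}^{p-1}(2k+1)A_k\equiv p-\frac{7}{2}p^2H_{p-1}\pmod{p^6},$$ where $A_k=\sum_{j=0}^{k}\binom{k+j}{j}^2\binom{k}{j}^2$ is the $k$-th Apéry number and $H_{p-1}=\sum_{j=1}^{p-1}\frac1j$.
   Context: Congruences between rational numbers modulo a power of $p$ are understood in the ring of rationals whose denominators are prime to $p$. *)

theory Defs
  imports Complex_Main "HOL-Computational_Algebra.Primes"
begin

(* quotient_of returns the reduced fraction with positive denominator. *)
definition p_integral :: "nat \<Rightarrow> rat set" where
  "p_integral p = {x. coprime (snd (quotient_of x)) (int p)}"

(* Congruence modulo the ideal generated by m in the ring p_integral p;
   both sides are required to be elements of that ring. *)
definition rat_cong :: "nat \<Rightarrow> rat \<Rightarrow> rat \<Rightarrow> nat \<Rightarrow> bool" where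
  "rat_cong p x y m \<longleftrightarrow>
     x \<in> p_integral p \<and> y \<in> p_integral p \<and> (\<exists>z\<in>p_integral p. x - y = of_nat m * z)"

definition apery :: "nat \<Rightarrow> nat" where
  "apery k = (\<Sum>j=0..k. ((k + j) choose j)\<^sup>2 * (k choose j)\<^sup>2)"

(* The library's harm needs a real normed field, which rat is not. *)
definition harmonic :: "nat \<Rightarrow> rat" where
  "harmonic n = (\<Sum>j=1..n. 1 / of_nat j)"

end

theory Submission
  imports Defs
begin

text \<open>
  Let c(j) be the product of the factors 1 - (p / i)^2 over i from 1 to j. Exchanging the order of
  summation and telescoping in k turns the sum S in question into the sum of
  p^2 c(j)^2 / (2 j + 1) over j < p. A WZ argument shows that the sum of p c(j) / (2 j + 1) is
  exactly 1, so writing c^2 = (1 - c)^2 + 2 c - 1 gives S as 2 p minus the sum of p^2 / (2 j + 1)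
  plus the sum of p^2 (1 - c(j))^2 / (2 j + 1). The last sum vanishes modulo p^6, since 1 - c(j) is
  divisible by p^2, and even by p^3 at the index j = (p - 1) / 2 where p divides the denominator.
  What remains is the sum of the reciprocals of the odd numbers below 2 p, which is
  1 / p + 7/2 H modulo p^4, with H the harmonic number of p - 1.
\<close>

subsection \<open>Divisibility by powers of p in the local ring\<close>

text \<open>Any fraction with denominator prime to \<open>p\<close> may be used, so sums and
  products need no reduction to lowest terms: the reduced denominator \<open>d\<close> divides every
  other denominator \<open>b\<close>.\<close>

lemma p_integral_iff:
  "x \<in> p_integral p \<longleftrightarrow> (\<exists>a b. b \<noteq> 0 \<and> coprime b (int p) \<and> x = of_int a / of_int b)"
proof
  assume x: "x \<in> p_integral p"
  obtain a b where ab: "quotient_of x = (a, b)" by (cases "quotient_of x")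
  have "b > 0" "x = of_int a / of_int b"
    using ab by (auto intro: quotient_of_denom_pos quotient_of_div)
  moreover have "coprime b (int p)" using x ab by (simp add: p_integral_def)
  ultimately show "\<exists>a b. b \<noteq> 0 \<and> coprime b (int p) \<and> x = of_int a / of_int b"
    by (intro exI[of _ a] exI[of _ b]) simp
next
  assume "\<exists>a b. b \<noteq> 0 \<and> coprime b (int p) \<and> x = of_int a / of_int b"
  then obtain a b where b: "b \<noteq> 0" "coprime b (int p)" "x = of_int a / of_int b" by blast
  obtain n d where nd: "quotient_of x = (n, d)" by (cases "quotient_of x")
  have d: "d > 0" "x = of_int n / of_int d" "coprime n d"
    using nd by (auto intro: quotient_of_denom_pos quotient_of_div quotient_of_coprime)
  have "(of_int (n * b) :: rat) = of_int (a * d)"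
    using b d by (simp add: field_simps)
  hence "n * b = a * d" by (simp only: of_int_eq_iff)
  hence "d dvd n * b" by (metis dvd_triv_right)
  moreover have "coprime d n" using d(3) by (rule coprime_imp_coprime) auto
  ultimately have "d dvd b" by (simp add: coprime_dvd_mult_right_iff)
  hence "coprime d (int p)" by (rule coprime_divisors[OF _ dvd_refl b(2)])
  thus "x \<in> p_integral p" using nd by (simp add: p_integral_def)
qed

lemma p_integral_of_int [simp]: "of_int a \<in> p_integral p"
  unfolding p_integral_iff by (rule exI[of _ a], rule exI[of _ 1]) simp

lemma p_integral_add:
  assumes "x \<in> p_integral p" "y \<in> p_integral p"
  shows "x + y \<in> p_integral p"
proof -
  obtain a b c d where *: "b \<noteq> 0" "coprime b (int p)" "x = of_int a / of_int b"
      "d \<noteq> 0" "coprime d (int p)" "y = of_int c / of_int d"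
    using assms by (auto simp: p_integral_iff)
  show ?thesis unfolding p_integral_iff
    using * by (intro exI[of _ "a * d + c * b"] exI[of _ "b * d"]) (simp add: field_simps)
qed

lemma p_integral_mult:
  assumes "x \<in> p_integral p" "y \<in> p_integral p"
  shows "x * y \<in> p_integral p"
proof -
  obtain a b c d where *: "b \<noteq> 0" "coprime b (int p)" "x = of_int a / of_int b"
      "d \<noteq> 0" "coprime d (int p)" "y = of_int c / of_int d"
    using assms by (auto simp: p_integral_iff)
  show ?thesis unfolding p_integral_iff
    using * by (intro exI[of _ "a * c"] exI[of _ "b * d"]) simp
qed

text \<open>Exponent 0 is membership in the local ring, so one family of rules tracks both
  integrality and divisibility.\<close>

definition ppow_dvd :: "nat \<Rightarrow> nat \<Rightarrow> rat \<Rightarrow> bool" where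
  "ppow_dvd p k x \<longleftrightarrow> (\<exists>z\<in>p_integral p. x = of_nat p ^ k * z)"

lemma ppow_dvd_0_iff: "ppow_dvd p 0 x \<longleftrightarrow> x \<in> p_integral p"
  by (simp add: ppow_dvd_def)

lemma ppow_dvd_of_int: "ppow_dvd p 0 (of_int a)"
  by (simp add: ppow_dvd_0_iff)

lemma ppow_dvd_of_nat: "ppow_dvd p 0 (of_nat a)"
  using ppow_dvd_of_int[of p "int a"] by simp

lemma ppow_dvd_zero [simp]: "ppow_dvd p k 0"
  unfolding ppow_dvd_def using p_integral_of_int[of 0 p] by (intro bexI[of _ 0]) simp_all

lemma ppow_dvd_power: "ppow_dvd p k (of_nat p ^ k)"
  unfolding ppow_dvd_def using p_integral_of_int[of 1 p] by (intro bexI[of _ 1]) simp_all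

lemma ppow_dvd_add: "ppow_dvd p k x \<Longrightarrow> ppow_dvd p k y \<Longrightarrow> ppow_dvd p k (x + y)"
  unfolding ppow_dvd_def by (metis distrib_left p_integral_add)

lemma ppow_dvd_mult: "ppow_dvd p k x \<Longrightarrow> ppow_dvd p l y \<Longrightarrow> ppow_dvd p (k + l) (x * y)"
proof -
  assume "ppow_dvd p k x" "ppow_dvd p l y"
  then obtain z w where "z \<in> p_integral p" "w \<in> p_integral p"
      "x = of_nat p ^ k * z" "y = of_nat p ^ l * w"
    by (auto simp: ppow_dvd_def)
  thus ?thesis unfolding ppow_dvd_def
    by (intro bexI[of _ "z * w"]) (simp_all add: power_add p_integral_mult)
qed

lemma ppow_dvd_mult_left: "ppow_dvd p 0 x \<Longrightarrow> ppow_dvd p l y \<Longrightarrow> ppow_dvd p l (x * y)"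
  using ppow_dvd_mult[of p 0 x l y] by simp

lemma ppow_dvd_mult_right: "ppow_dvd p l x \<Longrightarrow> ppow_dvd p 0 y \<Longrightarrow> ppow_dvd p l (x * y)"
  using ppow_dvd_mult[of p l x 0 y] by simp

lemma ppow_dvd_minus: "ppow_dvd p k x \<Longrightarrow> ppow_dvd p k (- x)"
  using ppow_dvd_mult_left[OF ppow_dvd_of_int[of p "-1"], of k x] by simp

lemma ppow_dvd_diff: "ppow_dvd p k x \<Longrightarrow> ppow_dvd p k y \<Longrightarrow> ppow_dvd p k (x - y)"
  using ppow_dvd_add[of p k x "- y"] ppow_dvd_minus[of p k y] by simp

lemma ppow_dvd_sum: "(\<And>i. i \<in> A \<Longrightarrow> ppow_dvd p k (f i)) \<Longrightarrow> ppow_dvd p k (sum f A)"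
  by (induction A rule: infinite_finite_induct) (auto intro: ppow_dvd_add)

lemma ppow_dvd_mono:
  assumes "ppow_dvd p k x" "l \<le> k"
  shows "ppow_dvd p l x"
proof -
  have "ppow_dvd p 0 (of_nat p ^ (k - l))"
    using ppow_dvd_of_nat[of p "p ^ (k - l)"] by simp
  moreover obtain z where "z \<in> p_integral p" "x = of_nat p ^ k * z"
    using assms(1) by (auto simp: ppow_dvd_def)
  ultimately show ?thesis using assms(2) unfolding ppow_dvd_def
    by (intro bexI[of _ "of_nat p ^ (k - l) * z"])
       (simp_all add: p_integral_mult flip: power_add mult.assoc)
qed

lemma ppow_dvd_inverse_of_int:
  assumes "prime p" "\<not> int p dvd a"
  shows "ppow_dvd p 0 (1 / of_int a)"
proof -
  have "coprime a (int p)"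
    using assms by (metis coprime_commute prime_imp_coprime prime_nat_int_transfer)
  moreover have "a \<noteq> 0" using assms by auto
  ultimately show ?thesis unfolding ppow_dvd_0_iff p_integral_iff
    by (intro exI[of _ 1] exI[of _ a]) simp
qed

lemma ppow_dvd_inverse_of_nat:
  assumes "prime p" "\<not> p dvd a"
  shows "ppow_dvd p 0 (1 / of_nat a)"
  using ppow_dvd_inverse_of_int[of p "int a"] assms by simp

lemma ppow_dvd_inverse_square:
  assumes "prime p" "\<not> p dvd a"
  shows "ppow_dvd p 0 (1 / (of_nat a)\<^sup>2)"
  using ppow_dvd_mult_left[OF ppow_dvd_inverse_of_nat[OF assms] ppow_dvd_inverse_of_nat[OF assms]]
  by (simp add: power2_eq_square)

lemma ppow_dvd_power_diff:
  assumes "ppow_dvd p 0 x" "ppow_dvd p 0 y" "ppow_dvd p k (x - y)"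
  shows "ppow_dvd p k (x ^ n - y ^ n)"
proof (induction n)
  case (Suc n)
  have "ppow_dvd p 0 (y ^ n)"
    using ppow_dvd_mult_left[OF assms(2)] ppow_dvd_of_nat[of p 1] by (induction n) auto
  moreover have "x ^ Suc n - y ^ Suc n = x * (x ^ n - y ^ n) + (x - y) * y ^ n"
    by (simp add: algebra_simps)
  ultimately show ?case
    using Suc assms by (auto intro: ppow_dvd_add ppow_dvd_mult_left ppow_dvd_mult_right)
qed simp

lemma ppow_dvd_cancel_of_nat:
  assumes "prime p" "\<not> p dvd a" "ppow_dvd p k (of_nat a * x)"
  shows "ppow_dvd p k x"
proof -
  have "a \<noteq> 0" using assms by (metis dvd_0_right)
  thus ?thesis
    using ppow_dvd_mult_left[OF ppow_dvd_inverse_of_nat[OF assms(1,2)] assms(3)] by simp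
qed

lemma not_dvd_interval: "0 < i \<Longrightarrow> i < p \<Longrightarrow> \<not> p dvd (i::nat)"
  by (auto dest: dvd_imp_le)

subsection \<open>Harmonic sums modulo p\<close>

text \<open>Modulo \<open>p\<close> the number p - i is -i, and squaring removes the sign;
  explicitly, i^2 - (p - i)^2 = p (2 i - p).\<close>

lemma ppow_dvd_inverse_square_reflect:
  assumes "prime p" "0 < i" "i < p"
  shows "ppow_dvd p 1 (1 / (of_nat (p - i))\<^sup>2 - 1 / (of_nat i)\<^sup>2)"
proof -
  have nd: "\<not> p dvd i" "\<not> p dvd (p - i)"
    using assms not_dvd_interval[of i p] not_dvd_interval[of "p - i" p] by auto
  note I = nd[THEN ppow_dvd_inverse_of_nat[OF assms(1)]]
  have "1 / (of_nat (p - i))\<^sup>2 - 1 / (of_nat i)\<^sup>2 =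
      of_nat p ^ 1 * ((of_int (2 * int i - int p) :: rat) *
        ((1 / of_nat (p - i) * (1 / of_nat (p - i))) * (1 / of_nat i * (1 / of_nat i))))"
    using assms by (simp add: of_nat_diff divide_simps) (simp add: algebra_simps power2_eq_square)
  thus ?thesis
    by (simp only:) (intro ppow_dvd_mult_right ppow_dvd_power ppow_dvd_of_int ppow_dvd_mult_left I)
qed

text \<open>For \<open>p = 2 * m + 1\<close> this is the pairing of \<open>i\<close> with
  \<open>p - i\<close>.\<close>

lemma sum_fold_middle:
  "sum f {1..2 * m} = (\<Sum>i=1..m. f i + f (2 * m + 1 - i))" for f :: "nat \<Rightarrow> 'a::comm_monoid_add"
proof -
  have "sum f {1..2 * m} = sum f {1..m} + sum f {m + 1..2 * m}"
    by (subst sum.union_disjoint[symmetric]) (auto intro: sum.cong)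
  also have "sum f {m + 1..2 * m} = (\<Sum>i=1..m. f (2 * m + 1 - i))"
    by (rule sum.reindex_bij_witness[of _ "\<lambda>i. 2 * m + 1 - i" "\<lambda>i. 2 * m + 1 - i"]) auto
  finally show ?thesis by (simp add: sum.distrib)
qed

lemma sum_split_parity:
  "sum f {1..2 * m} = (\<Sum>i=1..m. f (2 * i) + f (2 * m + 1 - 2 * i))"
  for f :: "nat \<Rightarrow> 'a::comm_monoid_add"
proof -
  have "sum f {1..2 * m} = sum f {i\<in>{1..2 * m}. even i} + sum f {i\<in>{1..2 * m}. odd i}"
    by (subst sum.union_disjoint[symmetric]) (auto intro: sum.cong)
  also have "sum f {i\<in>{1..2 * m}. even i} = (\<Sum>i=1..m. f (2 * i))"
    by (rule sum.reindex_bij_witness[of _ "\<lambda>i. 2 * i" "\<lambda>i. i div 2"]) (auto elim!: evenE)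
  also have "sum f {i\<in>{1..2 * m}. odd i} = (\<Sum>i=1..m. f (2 * m + 1 - 2 * i))"
    by (rule sum.reindex_bij_witness[of _ "\<lambda>i. 2 * m + 1 - 2 * i" "\<lambda>i. (2 * m + 1 - i) div 2"])
       (auto elim!: oddE simp flip: diff_mult_distrib2)
  finally show ?thesis by (simp add: sum.distrib)
qed

text \<open>Folding the range at its middle, directly and after splitting it by parity (the odd numbers
  below p being the p - 2i), evaluates the full sum as 2h and as 2h divided by a power of 4, where
  h is the half sum.\<close>

lemma ppow_dvd_harmonic_even:
  assumes "prime p" "p = 2 * m + 1" "\<not> p dvd (4 ^ n - 1)"
  shows "ppow_dvd p 1 (\<Sum>i=1..m. (1 / (of_nat i)\<^sup>2) ^ n)"
    and "ppow_dvd p 1 (\<Sum>i=1..2 * m. (1 / (of_nat i)\<^sup>2) ^ n)"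
proof -
  define f :: "nat \<Rightarrow> rat" where "f i = (1 / (of_nat i)\<^sup>2) ^ n" for i
  define h where "h = sum f {1..m}"
  have odd: "\<not> p dvd 2" using assms(1,2) primes_dvd_imp_eq[OF assms(1) two_is_prime_nat] by auto
  have f_reflect: "ppow_dvd p 1 (f (p - i) - f i)" if "0 < i" "i < p" for i
  proof -
    have nd: "\<not> p dvd i" "\<not> p dvd (p - i)"
      using that not_dvd_interval[of i p] not_dvd_interval[of "p - i" p] by auto
    show ?thesis unfolding f_def
      by (intro ppow_dvd_power_diff ppow_dvd_inverse_square nd
          ppow_dvd_inverse_square_reflect assms that)
  qed
  have "sum f {1..2 * m} - 2 * h = (\<Sum>i=1..m. f (p - i) - f i)"
    using sum_fold_middle[of f m] assms(2) by (simp add: h_def sum.distrib sum_subtractf)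
  hence full: "ppow_dvd p 1 (sum f {1..2 * m} - 2 * h)"
    using assms(2) f_reflect by (auto intro!: ppow_dvd_sum)
  have f2: "4 ^ n * f (2 * i) = f i" for i
    by (simp add: f_def power_mult_distrib power_divide)
  have "sum f {1..2 * m} - 2 * (\<Sum>i=1..m. f (2 * i)) = (\<Sum>i=1..m. f (p - 2 * i) - f (2 * i))"
    using sum_split_parity[of f m] assms(2) by (simp add: sum.distrib sum_subtractf)
  hence par: "ppow_dvd p 1 (sum f {1..2 * m} - 2 * (\<Sum>i=1..m. f (2 * i)))"
    using assms(2) f_reflect by (auto intro!: ppow_dvd_sum)
  have h2: "4 ^ n * (\<Sum>i=1..m. f (2 * i)) = h"
    by (simp only: sum_distrib_left f2 h_def)
  \<comment> \<open>Subtracting the two evaluations and clearing 4^n leaves (4^n - 1) 2 h, and both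
    factors in front of \<open>h\<close> are prime to \<open>p\<close>.\<close>
  have "ppow_dvd p 1 (of_nat (4 ^ n) * ((sum f {1..2 * m} - 2 * (\<Sum>i=1..m. f (2 * i)))
      - (sum f {1..2 * m} - 2 * h)))"
    by (intro ppow_dvd_mult_left ppow_dvd_of_nat ppow_dvd_diff par full)
  also have "of_nat (4 ^ n) * ((sum f {1..2 * m} - 2 * (\<Sum>i=1..m. f (2 * i)))
      - (sum f {1..2 * m} - 2 * h)) = of_nat (4 ^ n - 1) * (of_nat 2 * h)"
    using h2 by (simp add: of_nat_diff algebra_simps)
  finally have h: "ppow_dvd p 1 h"
    using odd assms by (blast intro: ppow_dvd_cancel_of_nat)
  thus "ppow_dvd p 1 (\<Sum>i=1..m. (1 / (of_nat i)\<^sup>2) ^ n)" by (simp add: h_def f_def)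
  have "ppow_dvd p 1 (sum f {1..2 * m})"
    using ppow_dvd_add[OF full ppow_dvd_mult_left[OF ppow_dvd_of_nat[of p 2] h]] by simp
  thus "ppow_dvd p 1 (\<Sum>i=1..2 * m. (1 / (of_nat i)\<^sup>2) ^ n)" by (simp add: f_def)
qed

section \<open>Reciprocals of odd numbers and shifted harmonic sums\<close>

text \<open>The even numbers up to \<open>2 * n\<close> account for \<open>harmonic n / 2\<close> of
  \<open>harmonic (2 * n)\<close>.\<close>

lemma sum_inverse_odd:
  "(\<Sum>j<n. 1 / (2 * of_nat j + 1)) = harmonic (2 * n) - harmonic n / 2"
proof (induction n)
  case (Suc n)
  have [simp]: "2 * of_nat n + 2 \<noteq> (0::rat)" "of_nat n + 1 \<noteq> (0::rat)" by (simp_all add: add_nonneg_eq_0_iff)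
  have "harmonic (2 * Suc n) = harmonic (2 * n) + 1 / (2 * of_nat n + 1) + 1 / (2 * of_nat n + 2)"
    by (simp add: harmonic_def add_ac)
  moreover have "harmonic (Suc n) = harmonic n + 1 / (of_nat n + 1)"
    by (simp add: harmonic_def add_ac)
  moreover have "1 / (of_nat n + 1) / 2 = (1 / (2 * of_nat n + 2) :: rat)"
    by (simp add: field_simps)
  ultimately show ?case using Suc by (simp add: add_divide_distrib)
qed (simp add: harmonic_def)

lemma harmonic_add: "harmonic (m + n) = harmonic m + (\<Sum>i=1..n. 1 / (of_nat m + of_nat i))"
  by (induction n) (simp_all add: harmonic_def)

text \<open>With u = i (p - i), the reflection of i pairs the summands to
  3 p / (u + 2 p^2) and 3 p / u respectively.\<close>

lemma harmonic_shift_cong: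
  assumes "prime p" "p \<ge> 7"
  shows "ppow_dvd p 4 ((\<Sum>i=1..p-1. 1 / (of_nat p + of_nat i)) - 3 * harmonic (p - 1))"
proof -
  obtain m where m: "p = 2 * m + 1"
    using assms prime_odd_nat[of p] by (auto elim!: oddE)
  \<comment> \<open>15 = 4^2 - 1 must be prime to \<open>p\<close> for the half sum of fourth powers
    to vanish; the bound \<open>p \<ge> 7\<close> excludes 3 and 5.\<close>
  have "\<not> p dvd 15"
  proof
    assume "p dvd 15"
    hence "p dvd 3 * 5" by simp
    hence "p dvd 3 \<or> p dvd 5" using assms(1) prime_dvd_mult_nat by blast
    thus False using assms(2) by (auto dest: dvd_imp_le)
  qed
  hence H4: "ppow_dvd p 1 (\<Sum>i=1..m. (1 / (of_nat i)\<^sup>2) ^ 2)"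
    using ppow_dvd_harmonic_even(1)[OF assms(1) m, of 2] by simp
  define d :: "nat \<Rightarrow> rat" where
    "d i = (1 / (of_nat p + of_nat i) + 1 / (of_nat p + of_nat (p - i))) -
      3 * (1 / of_nat i + 1 / of_nat (p - i))" for i
  \<comment> \<open>With u as above, \<open>d i\<close> is -6 p^3 / (u (u + 2 p^2)), and u is -i^2
    modulo \<open>p\<close>. Summation then leaves -6 p^3 times the sum in \<open>H4\<close>, which
    is itself divisible by \<open>p\<close>.\<close>
  have "ppow_dvd p 4 (d i + 6 * of_nat p ^ 3 * (1 / (of_nat i)\<^sup>2) ^ 2)" if i: "i \<in> {1..m}" for i
  proof -
    define q r s t :: rat where "q = of_nat p" "r = of_nat i" "s = of_nat (p + i)" 
      and "t = of_nat (p - i)"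
    define w :: rat where "w = of_nat (2 * p - i)"
    have rel: "t = q - r" "s = q + r" "w = 2 * q - r"
      using i m by (auto simp: q_r_s_def t_def w_def of_nat_diff)
    have pos: "q > 0" "r > 0" "s > 0" "t > 0" "w > 0"
      using i m by (auto simp: q_r_s_def t_def w_def)
    have "\<not> p dvd i" "\<not> p dvd (p - i)"
      using i m not_dvd_interval[of i p] not_dvd_interval[of "p - i" p] by auto
    moreover have "2 * p - i = p + (p - i)" using i m by auto
    ultimately have nd: "\<not> p dvd i" "\<not> p dvd (p + i)" "\<not> p dvd (p - i)" "\<not> p dvd (2 * p - i)"
      by (simp_all only: dvd_add_triv_left_iff not_False_eq_True)
    note inv = nd[THEN ppow_dvd_inverse_of_nat[OF assms(1)], folded q_r_s_def t_def w_def]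
    have intr: "ppow_dvd p 0 q" "ppow_dvd p 0 r"
      by (simp_all add: q_r_s_def ppow_dvd_of_nat)
    have "d i = (1 / s + 1 / w) - 3 * (1 / r + 1 / t)"
      using i m by (simp add: d_def q_r_s_def t_def w_def of_nat_diff) (simp add: algebra_simps)
    \<comment> \<open>Over the common denominator the numerator is 6 q^3 (s t w - r^3). Since s t w
      is r^3 modulo q, a fourth factor q splits off and leaves the quadratic cofactor.\<close>
    also have "\<dots> + 6 * q ^ 3 * (1 / r\<^sup>2) ^ 2 =
        q ^ 4 * (of_int (-6) * (2 * r * r + q * r - 2 * q * q) *
          ((1 / r * (1 / r)) * (1 / r * (1 / r))) * ((1 / s * (1 / t)) * (1 / w)))"
    proof -
      have "(1 / s + 1 / w) - 3 * (1 / r + 1 / t) + 6 * q ^ 3 * (1 / r\<^sup>2) ^ 2 =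
          (((w + s) * r * t - 3 * (r + t) * s * w) * r ^ 3 + 6 * q ^ 3 * (s * t * w)) / (r ^ 4 * s * t * w)"
        using pos by (simp add: field_simps eval_nat_numeral)
      also have "((w + s) * r * t - 3 * (r + t) * s * w) * r ^ 3 + 6 * q ^ 3 * (s * t * w) =
          q ^ 4 * (of_int (-6) * (2 * r * r + q * r - 2 * q * q))"
        unfolding rel by (simp add: algebra_simps eval_nat_numeral)
      finally show ?thesis by (simp add: field_simps eval_nat_numeral)
    qed
    finally have eq: "d i + 6 * q ^ 3 * (1 / r\<^sup>2) ^ 2 =
        q ^ 4 * (of_int (-6) * (2 * r * r + q * r - 2 * q * q) *
          ((1 / r * (1 / r)) * (1 / r * (1 / r))) * ((1 / s * (1 / t)) * (1 / w)))" .
    have two: "ppow_dvd p 0 2" using ppow_dvd_of_nat[of p 2] by simp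
    have "ppow_dvd p 4 (q ^ 4)" by (simp add: q_r_s_def ppow_dvd_power)
    hence "ppow_dvd p 4 (d i + 6 * q ^ 3 * (1 / r\<^sup>2) ^ 2)"
      unfolding eq
      by (intro ppow_dvd_mult_right ppow_dvd_mult_left ppow_dvd_of_int ppow_dvd_add ppow_dvd_diff
          intr inv two)
    thus ?thesis by (simp add: q_r_s_def)
  qed
  hence "ppow_dvd p 4 (\<Sum>i=1..m. d i + 6 * of_nat p ^ 3 * (1 / (of_nat i)\<^sup>2) ^ 2)"
    by (rule ppow_dvd_sum)
  hence D: "ppow_dvd p 4 (sum d {1..m} +
      of_nat 6 * (of_nat p ^ 3 * (\<Sum>i=1..m. (1 / (of_nat i)\<^sup>2) ^ 2)))"
    by (simp add: sum.distrib sum_distrib_left mult.assoc)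
  have "ppow_dvd p 4 (of_nat 6 * (of_nat p ^ 3 * (\<Sum>i=1..m. (1 / (of_nat i)\<^sup>2) ^ 2)))"
    using ppow_dvd_mult[OF ppow_dvd_power[of p 3] H4]
    by (intro ppow_dvd_mult_left[OF ppow_dvd_of_nat]) simp
  from ppow_dvd_diff[OF D this] have "ppow_dvd p 4 (sum d {1..m})" by simp
  also have "sum d {1..m} = (\<Sum>i=1..p-1. 1 / (of_nat p + of_nat i)) - 3 * harmonic (p - 1)"
    using sum_fold_middle[of "\<lambda>i. 1 / (of_nat p + of_nat i) :: rat" m]
      sum_fold_middle[of "\<lambda>i. 1 / of_nat i :: rat" m] m
    unfolding d_def harmonic_def sum_subtractf sum_distrib_left[symmetric] by simp
  finally show ?thesis .
qed

subsection \<open>The products of the factors 1 - (x / i)^2\<close>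

text \<open>This is (-1)^j times the binomials x - 1 over j and x + j over j. The parameter is a
  free rational because the summation argument shifts \<open>x\<close> by one and changes its
  sign.\<close>

definition apery_prod :: "rat \<Rightarrow> nat \<Rightarrow> rat" where
  "apery_prod x j = (\<Prod>i=1..j. 1 - x\<^sup>2 / (of_nat i)\<^sup>2)"

lemma apery_prod_0 [simp]: "apery_prod x 0 = 1"
  by (simp add: apery_prod_def)

lemma apery_prod_Suc: "apery_prod x (Suc j) = apery_prod x j * (1 - x\<^sup>2 / (of_nat j + 1)\<^sup>2)"
  by (simp add: apery_prod_def add.commute)

lemma apery_prod_minus: "apery_prod (- x) j = apery_prod x j"
  by (simp add: apery_prod_def)

lemma apery_prod_eq_0: "0 < n \<Longrightarrow> n \<le> j \<Longrightarrow> apery_prod (of_nat n) j = 0"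
  by (auto simp: apery_prod_def intro!: bexI[of _ n])

text \<open>Raising \<open>x\<close> by one shifts both strings of factors i - x and i + x, so
  nearly everything cancels: - x enters the first string, while j + 1 + x and j + 2 + x enter the
  second and 1 + x leaves it. Multiplied out, the relation also covers x = -1.\<close>

lemma apery_prod_shift:
  "(x + 1) * apery_prod (x + 1) (Suc j) * (of_nat j + 1)\<^sup>2 =
     - x * (of_nat j + 1 + x) * (of_nat j + 2 + x) * apery_prod x j"
proof (induction j)
  case 0
  show ?case by (simp add: apery_prod_Suc algebra_simps power2_eq_square)
next
  case (Suc j)
  define a :: rat where "a = of_nat j"
  have a: "a + 1 \<noteq> 0" "a + 2 \<noteq> 0" by (simp_all add: a_def add_nonneg_eq_0_iff)
  have S: "(1 - (x + 1)\<^sup>2 / (a + 2)\<^sup>2) * (a + 2)\<^sup>2 = (a + 1 - x) * (a + 3 + x)"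
    using a by (simp add: left_diff_distrib right_diff_distrib) (simp add: algebra_simps power2_eq_square)
  have T: "(a + 1)\<^sup>2 * (1 - x\<^sup>2 / (a + 1)\<^sup>2) = (a + 1 - x) * (a + 1 + x)"
    using a by (simp add: left_diff_distrib right_diff_distrib) (simp add: algebra_simps power2_eq_square)
  have "(a + 1)\<^sup>2 * ((x + 1) * apery_prod (x + 1) (Suc (Suc j)) * (a + 2)\<^sup>2) =
      ((x + 1) * apery_prod (x + 1) (Suc j) * (a + 1)\<^sup>2) * ((1 - (x + 1)\<^sup>2 / (a + 2)\<^sup>2) * (a + 2)\<^sup>2)"
    unfolding apery_prod_Suc[of _ "Suc j"] by (simp add: a_def add.commute add.left_commute)
  also have "\<dots> = (- x * (a + 1 + x) * (a + 2 + x) * apery_prod x j) * ((a + 1 - x) * (a + 3 + x))"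
    unfolding S using Suc by (simp add: a_def)
  also have "\<dots> = (- x * (a + 2 + x) * (a + 3 + x) * apery_prod x j) * ((a + 1 - x) * (a + 1 + x))"
    by (simp add: algebra_simps)
  also have "\<dots> = (a + 1)\<^sup>2 * (- x * (a + 2 + x) * (a + 3 + x) * apery_prod x (Suc j))"
    unfolding T[symmetric] apery_prod_Suc by (simp add: a_def)
  finally have "(x + 1) * apery_prod (x + 1) (Suc (Suc j)) * (a + 2)\<^sup>2 =
      - x * (a + 2 + x) * (a + 3 + x) * apery_prod x (Suc j)"
    using a by (metis mult_left_cancel power_not_zero)
  thus ?case by (simp add: a_def algebra_simps)
qed

text \<open>A WZ pair: divided by 2 j + 3 the right-hand side telescopes.\<close>

lemma apery_prod_step:
  "(x + 1) * apery_prod (x + 1) (Suc j) - (x - 1) * apery_prod (x - 1) (Suc j) =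
     2 * (2 * of_nat j + 3) * (apery_prod x (Suc j) - apery_prod x j)"
proof -
  define a :: rat where "a = of_nat j"
  have a: "(a + 1)\<^sup>2 \<noteq> 0" by (simp add: a_def add_nonneg_eq_0_iff)
  \<comment> \<open>The product is even in its parameter, so lowering \<open>x\<close> by one is the
    shift relation at \<open>- x\<close>.\<close>
  have "(x - 1) * apery_prod (x - 1) (Suc j) * (a + 1)\<^sup>2 =
      - ((- x + 1) * apery_prod (- x + 1) (Suc j) * (a + 1)\<^sup>2)"
    using apery_prod_minus[of "x - 1"] by (simp add: algebra_simps)
  also have "\<dots> = - x * (a + 1 - x) * (a + 2 - x) * apery_prod x j"
    using apery_prod_shift[of "- x" j] by (simp add: a_def apery_prod_minus)
  finally have "((x + 1) * apery_prod (x + 1) (Suc j) - (x - 1) * apery_prod (x - 1) (Suc j)) *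
      (a + 1)\<^sup>2 = - 2 * x\<^sup>2 * (2 * a + 3) * apery_prod x j"
    using apery_prod_shift[of x j] by (simp add: a_def algebra_simps power2_eq_square)
  also have "\<dots> = 2 * (2 * a + 3) * (apery_prod x (Suc j) - apery_prod x j) * (a + 1)\<^sup>2"
    using a by (simp add: apery_prod_Suc a_def field_simps)
  finally show ?thesis using a by (simp add: a_def)
qed

text \<open>The relation at \<open>j + 1\<close> has the factor 2 j + 3 = 2 (j + 1) + 1, which the
  denominator removes; the term at index 0 starts the telescoping with (x + 1) - (x - 1) = 2. The
  parameter moves in steps of two.\<close>

lemma sum_apery_prod_step:
  "(\<Sum>j\<le>N. (x + 1) * apery_prod (x + 1) j / (2 * of_nat j + 1)) -
     (\<Sum>j\<le>N. (x - 1) * apery_prod (x - 1) j / (2 * of_nat j + 1)) = 2 * apery_prod x N"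
proof (induction N)
  case (Suc N)
  have nz: "2 * of_nat N + 3 \<noteq> (0::rat)" by (simp add: add_nonneg_eq_0_iff)
  have "(x + 1) * apery_prod (x + 1) (Suc N) / (2 * of_nat (Suc N) + 1) -
      (x - 1) * apery_prod (x - 1) (Suc N) / (2 * of_nat (Suc N) + 1) =
      2 * (apery_prod x (Suc N) - apery_prod x N)"
    using apery_prod_step[of x N] nz by (simp add: nonzero_divide_eq_eq add_ac flip: diff_divide_distrib) (simp add: algebra_simps)
  with Suc show ?case by (simp add: algebra_simps)
qed simp

text \<open>The parameter climbs through the odd numbers from 1, where only the term at index 0
  survives. Each step passes over an even number that is at most \<open>N\<close>, so the boundary
  term contains a vanishing factor.\<close>

lemma sum_apery_prod_odd:
  assumes "2 * k \<le> N"
  shows "(\<Sum>j\<le>N. of_nat (2 * k + 1) * apery_prod (of_nat (2 * k + 1)) j / (2 * of_nat j + 1)) = 1"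
  using assms
proof (induction k)
  case 0
  have "(\<Sum>j\<le>N. apery_prod 1 j / (2 * of_nat j + 1)) =
      (\<Sum>j\<le>N. if j = 0 then 1 else 0 :: rat)"
    using apery_prod_eq_0[of 1] by (intro sum.cong) auto
  thus ?case by simp
next
  case (Suc k)
  have "apery_prod (of_nat (2 * k + 2)) N = 0"
    using Suc.prems by (intro apery_prod_eq_0) auto
  thus ?case
    using sum_apery_prod_step[of "of_nat (2 * k + 2)" N] Suc by (simp add: algebra_simps)
qed

subsection \<open>The sum of Apery numbers\<close>

text \<open>The square of this number is the summand of \<open>apery k\<close> at
  \<open>j\<close>.\<close>

definition apery_binom :: "nat \<Rightarrow> nat \<Rightarrow> nat" where
  "apery_binom k j = ((k + j) choose j) * (k choose j)"

text \<open>Ratio of consecutive terms, cleared of denominators. The difference of \<open>k\<close>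
  and \<open>j\<close> is taken in the rationals; for \<open>j\<close> above \<open>k\<close> both
  sides are zero.\<close>

lemma apery_binom_Suc:
  "(of_nat (apery_binom k (Suc j)) :: rat) * (of_nat j + 1)\<^sup>2 =
     of_nat (apery_binom k j) * (of_nat k + of_nat j + 1) * (of_nat k - of_nat j)"
proof -
  have "Suc j * ((k + Suc j) choose Suc j) = (k + Suc j) * ((k + j) choose j)"
    using Suc_times_binomial_eq[of "k + j" j] by (simp add: mult.commute)
  hence A: "((of_nat j + 1) * of_nat ((k + Suc j) choose Suc j) :: rat) =
      (of_nat k + of_nat j + 1) * of_nat ((k + j) choose j)"
    by (metis (no_types) add.assoc add.commute of_nat_Suc of_nat_add of_nat_mult)
  have B: "((of_nat j + 1) * of_nat (k choose Suc j) :: rat) = (of_nat k - of_nat j) * of_nat (k choose j)"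
  proof (cases "j \<le> k")
    case True
    have "Suc j * (k choose Suc j) = (k - j) * (k choose j)"
      using binomial_absorption[of j k] binomial_absorb_comp[of k j] by simp
    hence "(of_nat (Suc j * (k choose Suc j)) :: rat) = of_nat ((k - j) * (k choose j))" by simp
    thus ?thesis using True by (simp add: of_nat_diff algebra_simps)
  next
    case False
    thus ?thesis by (simp add: binomial_eq_0)
  qed
  have "of_nat (apery_binom k (Suc j)) * (of_nat j + 1)\<^sup>2 =
      ((of_nat j + 1) * of_nat ((k + Suc j) choose Suc j)) * ((of_nat j + 1) * of_nat (k choose Suc j) :: rat)"
    by (simp add: apery_binom_def power2_eq_square)
  also have "\<dots> = of_nat (apery_binom k j) * (of_nat k + of_nat j + 1) * (of_nat k - of_nat j)"
    unfolding A B by (simp add: apery_binom_def)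
  finally show ?thesis .
qed

text \<open>In binomials this is n C(n - 1, j) = (n - j) C(n, j), multiplied by C(n + j, j).\<close>

lemma apery_prod_binom:
  "of_nat n * apery_prod (of_nat n) j * (-1) ^ j = (of_nat n - of_nat j) * of_nat (apery_binom n j)"
proof (induction j)
  case (Suc j)
  define a N :: rat where "a = of_nat j" and "N = of_nat n"
  have a: "(a + 1)\<^sup>2 \<noteq> 0" by (simp add: a_def add_nonneg_eq_0_iff)
  have "(N * apery_prod N (Suc j) * (-1) ^ Suc j) * (a + 1)\<^sup>2 =
      - (N * apery_prod N j * (-1) ^ j) * ((1 - N\<^sup>2 / (a + 1)\<^sup>2) * (a + 1)\<^sup>2)"
    by (simp add: apery_prod_Suc a_def)
  also have "(1 - N\<^sup>2 / (a + 1)\<^sup>2) * (a + 1)\<^sup>2 = (a + 1)\<^sup>2 - N\<^sup>2"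
    using a by (simp add: left_diff_distrib)
  also have "N * apery_prod N j * (-1) ^ j = (N - a) * of_nat (apery_binom n j)"
    using Suc by (simp add: N_def a_def)
  also have "- ((N - a) * of_nat (apery_binom n j)) * ((a + 1)\<^sup>2 - N\<^sup>2) =
      (N - a - 1) * (of_nat (apery_binom n j) * (N + a + 1) * (N - a))"
    by (simp add: algebra_simps power2_eq_square)
  also have "\<dots> = ((N - a - 1) * of_nat (apery_binom n (Suc j))) * (a + 1)\<^sup>2"
    using apery_binom_Suc[of n j] by (simp add: N_def a_def)
  finally have "N * apery_prod N (Suc j) * (-1) ^ Suc j = (N - a - 1) * of_nat (apery_binom n (Suc j))"
    using a by (metis mult_right_cancel)
  thus ?case by (simp add: N_def a_def algebra_simps)
qed (simp add: apery_binom_def)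

text \<open>In binomials this is (n + 1) C(n + 1 + j, j) = (n + j + 1) C(n + j, j), multiplied by
  C(n, j). Together with \<open>apery_prod_binom\<close> it expresses the values at \<open>n\<close>
  and \<open>Suc n\<close> through the same \<open>apery_binom n j\<close>.\<close>

lemma apery_prod_Suc_binom:
  "of_nat (Suc n) * apery_prod (of_nat (Suc n)) j * (-1) ^ j =
     (of_nat n + of_nat j + 1) * of_nat (apery_binom n j)"
proof (induction j)
  case (Suc j)
  define a N :: rat where "a = of_nat j" and "N = of_nat n"
  have a: "(a + 1)\<^sup>2 \<noteq> 0" by (simp add: a_def add_nonneg_eq_0_iff)
  have "((N + 1) * apery_prod (N + 1) (Suc j) * (-1) ^ Suc j) * (a + 1)\<^sup>2 =
      - ((N + 1) * apery_prod (N + 1) j * (-1) ^ j) * ((1 - (N + 1)\<^sup>2 / (a + 1)\<^sup>2) * (a + 1)\<^sup>2)"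
    by (simp add: apery_prod_Suc a_def)
  also have "(1 - (N + 1)\<^sup>2 / (a + 1)\<^sup>2) * (a + 1)\<^sup>2 = (a + 1)\<^sup>2 - (N + 1)\<^sup>2"
    using a by (simp add: left_diff_distrib)
  also have "(N + 1) * apery_prod (N + 1) j * (-1) ^ j = (N + a + 1) * of_nat (apery_binom n j)"
    using Suc by (simp add: N_def a_def add.commute)
  also have "- ((N + a + 1) * of_nat (apery_binom n j)) * ((a + 1)\<^sup>2 - (N + 1)\<^sup>2) =
      (N + a + 2) * (of_nat (apery_binom n j) * (N + a + 1) * (N - a))"
    by (simp add: algebra_simps power2_eq_square)
  also have "\<dots> = ((N + a + 2) * of_nat (apery_binom n (Suc j))) * (a + 1)\<^sup>2"
    using apery_binom_Suc[of n j] by (simp add: N_def a_def)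
  finally have "(N + 1) * apery_prod (N + 1) (Suc j) * (-1) ^ Suc j = (N + a + 2) * of_nat (apery_binom n (Suc j))"
    using a by (metis mult_right_cancel)
  thus ?case by (simp add: N_def a_def add.commute add.left_commute)
qed (simp add: apery_binom_def add.commute)

text \<open>The sum telescopes because (n + j + 1)^2 - (n - j)^2 = (2 n + 1) (2 j + 1); squaring
  removes the signs (-1)^j.\<close>

lemma sum_apery_binom:
  "(\<Sum>k<n. (2 * of_nat k + 1) * (of_nat (apery_binom k j))\<^sup>2) =
     (of_nat n)\<^sup>2 * (apery_prod (of_nat n) j)\<^sup>2 / (2 * of_nat j + 1)"
proof (induction n)
  case (Suc n)
  define a N b :: rat where "a = of_nat j" and "N = of_nat n" and "b = of_nat (apery_binom n j)"
  have a: "2 * a + 1 \<noteq> 0" by (simp add: a_def add_nonneg_eq_0_iff)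
  have sgn: "x\<^sup>2 * y\<^sup>2 = (x * y * (-1) ^ j)\<^sup>2" for x y :: rat
    by (simp add: power_mult_distrib flip: power_mult)
  have "N\<^sup>2 * (apery_prod N j)\<^sup>2 = ((N - a) * b)\<^sup>2"
    unfolding sgn using apery_prod_binom[of n j] by (simp add: a_def N_def b_def)
  moreover have "(of_nat (Suc n))\<^sup>2 * (apery_prod (of_nat (Suc n)) j)\<^sup>2 = ((N + a + 1) * b)\<^sup>2"
    unfolding sgn apery_prod_Suc_binom by (simp add: a_def N_def b_def)
  moreover have "((N - a) * b)\<^sup>2 / (2 * a + 1) + (2 * N + 1) * b\<^sup>2 = ((N + a + 1) * b)\<^sup>2 / (2 * a + 1)"
    using a by (simp add: field_simps power2_eq_square)
  ultimately show ?case using Suc by (simp add: a_def N_def b_def)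
qed simp

lemma sum_apery:
  "(\<Sum>k<n. (2 * of_nat k + 1) * of_nat (apery k)) =
     (\<Sum>j<n. (of_nat n)\<^sup>2 * (apery_prod (of_nat n) j)\<^sup>2 / (2 * of_nat j + 1))"
proof -
  have "of_nat (apery k) = (\<Sum>j<n. (of_nat (apery_binom k j))\<^sup>2 :: rat)" if "k < n" for k
  proof -
    have "apery k = (\<Sum>j=0..k. (apery_binom k j)\<^sup>2)"
      by (simp add: apery_def apery_binom_def power_mult_distrib)
    \<comment> \<open>Extending the range of \<open>j\<close> beyond \<open>k\<close> adds only
      zeros and makes it independent of \<open>k\<close>, so that the two sums can be
      exchanged.\<close>
    also have "\<dots> = (\<Sum>j<n. (apery_binom k j)\<^sup>2)"
      using that by (intro sum.mono_neutral_left) (auto simp: apery_binom_def)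
    finally show ?thesis by simp
  qed
  hence "(\<Sum>k<n. (2 * of_nat k + 1) * of_nat (apery k)) =
      (\<Sum>k<n. \<Sum>j<n. (2 * of_nat k + 1) * (of_nat (apery_binom k j))\<^sup>2 :: rat)"
    by (simp add: sum_distrib_left)
  also have "\<dots> = (\<Sum>j<n. \<Sum>k<n. (2 * of_nat k + 1) * (of_nat (apery_binom k j))\<^sup>2)"
    by (rule sum.swap)
  finally show ?thesis by (simp only: sum_apery_binom)
qed

section \<open>Expansion of the products modulo powers of p\<close>

text \<open>Expanding in powers of p^2, all coefficients are integral at \<open>p\<close> because
  the indices stay below \<open>p\<close>; beyond the linear term everything carries p^4.\<close>

lemma apery_prod_cong:
  assumes "prime p" "j < p"
  shows "ppow_dvd p 4 (apery_prod (of_nat p) j - 1 + (of_nat p)\<^sup>2 * (\<Sum>i=1..j. 1 / (of_nat i)\<^sup>2))"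
  using assms(2)
proof (induction j)
  case (Suc j)
  define h :: rat where "h = (\<Sum>i=1..j. 1 / (of_nat i)\<^sup>2)"
  define u :: rat where "u = 1 / (of_nat (Suc j))\<^sup>2"
  define e where "e = apery_prod (of_nat p) j - 1 + (of_nat p)\<^sup>2 * h"
  have sq: "ppow_dvd p 0 (1 / (of_nat i)\<^sup>2)" if "0 < i" "i < p" for i
    using ppow_dvd_inverse_square[OF assms(1) not_dvd_interval[OF that]] .
  have u: "ppow_dvd p 0 u" unfolding u_def using Suc.prems by (intro sq) auto
  have h: "ppow_dvd p 0 h" unfolding h_def using Suc.prems by (intro ppow_dvd_sum sq) auto
  have e: "ppow_dvd p 4 e" unfolding e_def h_def using Suc by simp
  have step: "apery_prod (of_nat p) (Suc j) = apery_prod (of_nat p) j * (1 - (of_nat p)\<^sup>2 * u)"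
    by (simp add: apery_prod_Suc u_def add.commute)
  \<comment> \<open>On multiplying out, the terms linear in p^2 cancel; besides multiples of the old
    error \<open>e\<close> only p^4 h u is left.\<close>
  have "apery_prod (of_nat p) (Suc j) - 1 + (of_nat p)\<^sup>2 * (h + u) =
      e + of_nat p ^ 4 * (h * u) - of_nat (p\<^sup>2) * (u * e)"
    unfolding step e_def by (simp add: algebra_simps eval_nat_numeral)
  moreover have "ppow_dvd p 4 \<dots>"
    by (intro ppow_dvd_diff ppow_dvd_add ppow_dvd_mult_left ppow_dvd_of_nat u e
        ppow_dvd_mult_right[OF ppow_dvd_power] h)
  ultimately show ?case by (simp add: h_def u_def)
qed simp

lemma apery_prod_cong_1:
  assumes "prime p" "j < p"
  shows "ppow_dvd p 2 (1 - apery_prod (of_nat p) j)"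
proof -
  have "ppow_dvd p 2 ((of_nat p)\<^sup>2 * (\<Sum>i=1..j. 1 / (of_nat i)\<^sup>2))"
    using assms
    by (intro ppow_dvd_mult_right[OF ppow_dvd_power] ppow_dvd_sum ppow_dvd_inverse_square
        not_dvd_interval) auto
  from ppow_dvd_diff[OF this ppow_dvd_mono[OF apery_prod_cong[OF assms]]] show ?thesis by simp
qed

text \<open>The third factor \<open>p\<close> comes from the half sum of the 1 / i^2, which is
  divisible by \<open>p\<close> since 4^1 - 1 = 3 is prime to \<open>p\<close>.\<close>

lemma apery_prod_middle_cong_1:
  assumes "prime p" "p \<ge> 5" "p = 2 * m + 1"
  shows "ppow_dvd p 3 (1 - apery_prod (of_nat p) m)"
proof -
  have "\<not> p dvd 4 ^ 1 - 1" using assms(2) by (auto dest: dvd_imp_le)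
  hence "ppow_dvd p 1 (\<Sum>i=1..m. 1 / (of_nat i)\<^sup>2)"
    using ppow_dvd_harmonic_even(1)[OF assms(1,3), of 1] by simp
  hence "ppow_dvd p 3 ((of_nat p)\<^sup>2 * (\<Sum>i=1..m. 1 / (of_nat i)\<^sup>2))"
    using ppow_dvd_mult[OF ppow_dvd_power[of p 2]] by fastforce
  moreover have "m < p" using assms(3) by simp
  ultimately show ?thesis
    using ppow_dvd_diff[OF _ ppow_dvd_mono[OF apery_prod_cong[OF assms(1)]]] by fastforce
qed

lemma ppow_dvd_sum_apery_prod_defect:
  assumes "prime p" "p \<ge> 5"
  shows "ppow_dvd p 6 (\<Sum>j<p. (of_nat p)\<^sup>2 * (1 - apery_prod (of_nat p) j)\<^sup>2 / (2 * of_nat j + 1))"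
proof (rule ppow_dvd_sum)
  fix j assume "j \<in> {..<p}"
  hence j: "j < p" by simp
  define y where "y = 1 - apery_prod (of_nat p) j"
  show "ppow_dvd p 6 ((of_nat p)\<^sup>2 * (1 - apery_prod (of_nat p) j)\<^sup>2 / (2 * of_nat j + 1))"
  proof (cases "p = 2 * j + 1")
    case True
    have y: "ppow_dvd p 3 y" unfolding y_def by (intro apery_prod_middle_cong_1 assms True)
    \<comment> \<open>One factor of p^2 cancels against the denominator 2 j + 1 = p, which leaves
      the exponent 1 + 3 + 3.\<close>
    have "ppow_dvd p 7 (of_nat p ^ 1 * (y * y))"
      using ppow_dvd_mult[OF ppow_dvd_power[of p 1] ppow_dvd_mult[OF y y]] by simp
    moreover have "of_nat p ^ 1 * (y * y) = (of_nat p)\<^sup>2 * y\<^sup>2 / of_nat p"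
      using assms by (simp add: power2_eq_square)
    moreover have "(of_nat p :: rat) = 2 * of_nat j + 1" using True by simp
    ultimately show ?thesis by (auto simp: y_def intro: ppow_dvd_mono)
  next
    case False
    \<comment> \<open>2 j + 1 is positive and below 2 p, so the only multiple of \<open>p\<close> it
      could be is \<open>p\<close> itself.\<close>
    have "\<not> p dvd 2 * j + 1"
    proof
      assume "p dvd 2 * j + 1"
      then obtain k where k: "2 * j + 1 = p * k" by (auto elim: dvdE)
      hence "p * k < p * 2" using j by linarith
      hence "k < 2" by simp
      moreover have "k \<noteq> 0" using k by (cases k) auto
      ultimately have "k = 1" by simp
      thus False using k False by simp
    qed
    from ppow_dvd_inverse_of_nat[OF assms(1) this]
    have inv: "ppow_dvd p 0 (1 / (2 * of_nat j + 1))" by (simp add: add.commute)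
    have y: "ppow_dvd p 2 y" unfolding y_def by (intro apery_prod_cong_1 assms j)
    have "ppow_dvd p 6 ((of_nat p)\<^sup>2 * (y * y) * (1 / (2 * of_nat j + 1)))"
      using ppow_dvd_mult_right[OF ppow_dvd_mult[OF ppow_dvd_power[of p 2] ppow_dvd_mult[OF y y]] inv]
      by simp
    thus ?thesis by (simp add: y_def power2_eq_square)
  qed
qed

theorem theorem1p1:
  fixes p :: nat
  assumes "prime p" and "p \<ge> 7"
  shows "rat_cong p
           (\<Sum>k=0..p-1. (2 * of_nat k + 1) * of_nat (apery k))
           (of_nat p - 7 / 2 * (of_nat p)\<^sup>2 * harmonic (p - 1))
           (p ^ 6)"
proof -
  obtain m where m: "p = 2 * m + 1"
    using assms prime_odd_nat[of p] by (auto elim!: oddE)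
  define q :: rat where "q = of_nat p"
  define c where "c = apery_prod q"
  define H where "H = harmonic (p - 1)"
  define S :: rat where "S = (\<Sum>k=0..p-1. (2 * of_nat k + 1) * of_nat (apery k))"
  define R where "R = (\<Sum>i=1..p-1. 1 / (q + of_nat i))"
  define E where "E = (\<Sum>j<p. q\<^sup>2 * (1 - c j)\<^sup>2 / (2 * of_nat j + 1))"
  have q: "q \<noteq> 0" using m by (simp add: q_def)
  have range: "{0..p - 1} = {..<p}" "{..2 * m} = {..<p}" using m by auto
  have S: "S = (\<Sum>j<p. q\<^sup>2 * (c j)\<^sup>2 / (2 * of_nat j + 1))"
    unfolding S_def c_def q_def range by (rule sum_apery)
  \<comment> \<open>With \<open>k = m\<close> and \<open>N = 2 * m\<close> the odd parameter is
    \<open>p\<close>, and the bound on \<open>k\<close> holds with equality.\<close>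
  have one: "(\<Sum>j<p. q * c j / (2 * of_nat j + 1)) = 1"
    using sum_apery_prod_odd[of m "2 * m", folded m] unfolding range c_def q_def by simp
  have odd: "(\<Sum>j<p. 1 / (2 * of_nat j + 1)) = 1 / q + H / 2 + R"
  proof -
    have p: "p = Suc (p - 1)" "2 * p = p + Suc (p - 1)" using m by auto
    have "harmonic p = H + 1 / q"
      unfolding H_def q_def using m by (simp add: harmonic_def)
    \<comment> \<open>The last index i = p of the shifted sum gives 1 / (2 q), and the indices below
      it make up \<open>R\<close>.\<close>
    moreover have "harmonic (2 * p) = harmonic p + R + 1 / (2 * q)"
      unfolding R_def q_def p(2) harmonic_add using m by simp
    ultimately show ?thesis unfolding sum_inverse_odd using q by (simp add: field_simps)
  qed
  have "E = (\<Sum>j<p. q\<^sup>2 * (c j)\<^sup>2 / (2 * of_nat j + 1) - 2 * q * (q * c j / (2 * of_nat j + 1))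
      + q\<^sup>2 * (1 / (2 * of_nat j + 1)))"
    unfolding E_def
    by (intro sum.cong refl) (simp add: power2_diff add_divide_distrib diff_divide_distrib algebra_simps power2_eq_square)
  also have "\<dots> = S - 2 * q * 1 + q\<^sup>2 * (1 / q + H / 2 + R)"
    unfolding sum.distrib sum_subtractf sum_distrib_left[symmetric] one odd S ..
  \<comment> \<open>Writing \<open>R\<close> as 3 H plus an error produces the coefficient 1/2 + 3 =
    7/2.\<close>
  also have "\<dots> = S - (q - 7 / 2 * q\<^sup>2 * H) + q\<^sup>2 * (R - 3 * H)"
    using q by (simp add: field_simps power2_eq_square)
  finally have diff: "S - (q - 7 / 2 * q\<^sup>2 * H) = E - q\<^sup>2 * (R - 3 * H)" by simp
  have "ppow_dvd p 6 E"
    unfolding E_def c_def q_def using assms by (intro ppow_dvd_sum_apery_prod_defect) auto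
  moreover have "ppow_dvd p 6 (q\<^sup>2 * (R - 3 * H))"
    using ppow_dvd_mult[OF ppow_dvd_power[of p 2] harmonic_shift_cong[OF assms]]
    by (simp add: q_def R_def H_def)
  ultimately have main: "ppow_dvd p 6 (S - (q - 7 / 2 * q\<^sup>2 * H))"
    unfolding diff by (rule ppow_dvd_diff)
  have "S = of_nat (\<Sum>k=0..p-1. (2 * k + 1) * apery k)" by (simp add: S_def algebra_simps)
  hence S0: "ppow_dvd p 0 S" by (simp only: ppow_dvd_of_nat)
  \<comment> \<open>The right-hand side is the integer \<open>S\<close> minus a multiple of p^6 in
    the local ring, hence integral.\<close>
  have "ppow_dvd p 0 (q - 7 / 2 * q\<^sup>2 * H)"
    using ppow_dvd_diff[OF S0 ppow_dvd_mono[OF main]] by simp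
  with S0 main show ?thesis
    by (simp add: rat_cong_def ppow_dvd_0_iff ppow_dvd_def S_def q_def H_def)
qed

end
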